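(* Let $F(\theta)=\frac12(\theta-\mu^\star)^\top\mathbf{A}(\theta-\mu^\star)$ for a diagonal positive definite matrix $\mathbf{A}\in\mathbb{R}^{d\times d}$ and $\mu^\star\in\mathbb{R}^d$. For a diagonal matrix $\mathbf{C}$ with entries in $[0,1]$, $\beta\in(0,1)$ and $\eta>0$, let $(\theta_k,\widehat{\theta}_{\mathrm{EMA},k})$ evolve according to $$\theta_{k+1}=\theta_k-\eta\,g_k+\mathbf{C}\left(\widehat{\theta}_{\mathrm{EMA},k}-\theta_k\right),\qquad \widehat{\theta}_{\mathrm{EMA},k+1}=(1-\beta)\widehat{\theta}_{\mathrm{EMA},k}+\beta\,\theta_{k+1},$$ with stochastic gradients $g_k=\mathbf{A}(\theta_k-\mu^\star)+\xi_k$, where $\xi_k$ are i.i.d. zero-mean noise terms with covariance $\sigma^2\mathbf{I}$, $\sigma>0$. Then for any learning rate $\eta>0$ with $\|\eta\mathbf{A}\|_{\mathrm{op}}<1$ and any $\beta\in(0,1)$, there is some such $\mathbf{C}$ for which $$\lim_{T\to\infty}\mathbb{E}\left[\|\widehat{\theta}_{\mathrm{EMA},T}-\mu^\star\|^2\right]$$ is strictly smaller than the limiting squared error of the iterate-average estimator returned by SGD.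
   Context: The iterate-average estimator returned by SGD is the exponential moving average, with the same $\eta$ and $\beta$, of the plain SGD iterates, i.e. $\widehat{\theta}_{\mathrm{EMA},T}$ for the recursion with $\mathbf{C}=0$; its limiting squared error is $\lim_{T\to\infty}\mathbb{E}[\|\widehat{\theta}_{\mathrm{EMA},T}-\mu^\star\|^2]$ for that recursion. The processes are started from deterministic initial values. $\|\cdot\|$ is the Euclidean norm and $\|\cdot\|_{\mathrm{op}}$ the operator norm. *)

theory Defs
  imports "HOL-Probability.Probability"
begin

definition diagonal_matrix :: "real^'n^'n \<Rightarrow> bool" where
  "diagonal_matrix A \<longleftrightarrow> (\<forall>i j. i \<noteq> j \<longrightarrow> A $ i $ j = 0)"

definition positive_definite :: "real^'n^'n \<Rightarrow> bool" where
  "positive_definite A \<longleftrightarrow> transpose A = A \<and> (\<forall>x. x \<noteq> 0 \<longrightarrow> x \<bullet> (A *v x) > 0)"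

definition covariance_matrix :: "'a measure \<Rightarrow> ('a \<Rightarrow> real^'n) \<Rightarrow> real^'n^'n" where
  "covariance_matrix M X = (\<chi> i j.
     \<integral>\<omega>. (X \<omega> $ i - (\<integral>\<omega>'. X \<omega>' $ i \<partial>M)) * (X \<omega> $ j - (\<integral>\<omega>'. X \<omega>' $ j \<partial>M)) \<partial>M)"

text \<open>
  The square-integrability clause says that the covariance exists: the Bochner integral of a
  non-integrable function is 0, so the mean and covariance clauses need it to be meaningful.
\<close>

definition iid_noise :: "'a measure \<Rightarrow> real \<Rightarrow> (nat \<Rightarrow> 'a \<Rightarrow> real^'n) \<Rightarrow> bool" where
  "iid_noise M \<sigma> \<xi> \<longleftrightarrow>
     prob_space.indep_vars M (\<lambda>_. borel) \<xi> UNIV \<and>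
     (\<forall>k. distr M borel (\<xi> k) = distr M borel (\<xi> 0)) \<and>
     (\<forall>k. integrable M (\<lambda>\<omega>. (norm (\<xi> k \<omega>))\<^sup>2)) \<and>
     (\<forall>k. (\<integral>\<omega>. \<xi> k \<omega> \<partial>M) = 0) \<and>
     (\<forall>k. covariance_matrix M (\<xi> k) = \<sigma>\<^sup>2 *\<^sub>R mat 1)"

definition objective :: "real^'n^'n \<Rightarrow> real^'n \<Rightarrow> real^'n \<Rightarrow> real" where
  "objective A \<mu> \<theta> = (1/2) * ((\<theta> - \<mu>) \<bullet> (A *v (\<theta> - \<mu>)))"

text \<open>The exact gradient of the objective is \<open>A *v (\<theta> - \<mu>)\<close>; a stochastic gradient adds noise to it.\<close>

lemma objective_gradient:
  fixes A :: "real^'n^'n"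
  assumes "transpose A = A"
  shows "(objective A \<mu> has_derivative (\<lambda>h. (A *v (\<theta> - \<mu>)) \<bullet> h)) (at \<theta>)"
proof -
  have lin: "bounded_linear ((*v) A)" by simp
  have "((\<lambda>\<theta>. A *v (\<theta> - \<mu>)) has_derivative (\<lambda>h. A *v h)) (at \<theta>)"
    by (rule bounded_linear.has_derivative[OF lin]) (auto intro!: derivative_eq_intros)
  then have "(objective A \<mu> has_derivative
      (\<lambda>h. (1/2) * ((\<theta> - \<mu>) \<bullet> (A *v h) + h \<bullet> (A *v (\<theta> - \<mu>))))) (at \<theta>)"
    unfolding objective_def by (auto intro!: derivative_eq_intros)
  moreover have "(\<theta> - \<mu>) \<bullet> (A *v h) = h \<bullet> (A *v (\<theta> - \<mu>))" for h
    by (metis assms dot_lmul_matrix inner_commute transpose_matrix_vector)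
  ultimately show ?thesis
    by (simp add: inner_commute)
qed

definition stochastic_gradient ::
    "real^'n^'n \<Rightarrow> real^'n \<Rightarrow> real^'n \<Rightarrow> real^'n \<Rightarrow> real^'n" where
  "stochastic_gradient A \<mu> noise \<theta> = A *v (\<theta> - \<mu>) + noise"

text \<open>
  The pair of the iterate and its exponential moving average after \<open>k\<close> steps, for one
  realization \<open>z\<close> of the noise sequence. With \<open>C = 0\<close> the first component is plain SGD.
\<close>

primrec ema_sgd ::
    "real^'n^'n \<Rightarrow> real^'n \<Rightarrow> real^'n^'n \<Rightarrow> real \<Rightarrow> real \<Rightarrow> (nat \<Rightarrow> real^'n) \<Rightarrow>
     real^'n \<Rightarrow> real^'n \<Rightarrow> nat \<Rightarrow> (real^'n) \<times> (real^'n)" where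
  "ema_sgd A \<mu> C \<eta> \<beta> z \<theta>0 m0 0 = (\<theta>0, m0)"
| "ema_sgd A \<mu> C \<eta> \<beta> z \<theta>0 m0 (Suc k) =
     (let (\<theta>, m) = ema_sgd A \<mu> C \<eta> \<beta> z \<theta>0 m0 k;
          \<theta>' = \<theta> - \<eta> *\<^sub>R stochastic_gradient A \<mu> (z k) \<theta> + C *v (m - \<theta>)
      in (\<theta>', (1 - \<beta>) *\<^sub>R m + \<beta> *\<^sub>R \<theta>'))"

definition ema_sq_error ::
    "'a measure \<Rightarrow> (nat \<Rightarrow> 'a \<Rightarrow> real^'n) \<Rightarrow> real^'n^'n \<Rightarrow> real^'n \<Rightarrow> real^'n^'n \<Rightarrow> real \<Rightarrow> real \<Rightarrow>
     real^'n \<Rightarrow> real^'n \<Rightarrow> nat \<Rightarrow> real" where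
  "ema_sq_error M \<xi> A \<mu> C \<eta> \<beta> \<theta>0 m0 T =
     (\<integral>\<omega>. (norm (snd (ema_sgd A \<mu> C \<eta> \<beta> (\<lambda>k. \<xi> k \<omega>) \<theta>0 m0 T) - \<mu>))\<^sup>2 \<partial>M)"

end

theory Submission
  imports Defs
begin

text \<open>
  With \<open>C = I - \<eta> A\<close> the iterate \<open>\<theta>\<^sub>k\<close> cancels from the recursion, and the average becomes an
  AR(1) process in each coordinate. Writing \<open>q = 1 - \<eta> A\<^sub>i\<^sub>i\<close> and \<open>b = 1 - \<beta>\<close>, its autoregression
  coefficient is \<open>b + q - b q\<close>, so its second moment tends to
  \<open>\<beta>\<^sup>2 \<eta>\<^sup>2 \<sigma>\<^sup>2 / ((1 - b) (1 - q) (1 + b + q - b q))\<close>. For \<open>C = 0\<close> the second moments obey a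
  triangular linear recursion whose limit is
  \<open>\<beta>\<^sup>2 \<eta>\<^sup>2 \<sigma>\<^sup>2 (1 + q b) / ((1 - q b) (1 - q\<^sup>2) (1 - b\<^sup>2))\<close>. After cross-multiplication the difference
  of the two is \<open>2 b q (b + q) > 0\<close>.
\<close>

section \<open>Limits of affine recursions\<close>

text \<open>The deviation from the fixed point \<open>l / (1 - r)\<close> is contracted by
  \<open>r\<close> and perturbed only by \<open>w k - l\<close>, which vanishes. A varying
  \<open>w\<close> is allowed because the forcing of one moment is built from moments already known
  to converge.\<close>

lemma tendsto_affine_recursion:
  fixes u w :: "nat \<Rightarrow> real"
  assumes step: "\<And>k. u (Suc k) = r * u k + w k" and r: "\<bar>r\<bar> < 1" and w: "w \<longlonglongrightarrow> l"
  shows "u \<longlonglongrightarrow> l / (1 - r)"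
proof -
  define d where "d k = u k - l / (1 - r)" for k
  have d_step: "d (Suc k) = r * d k + (w k - l)" for k
    using r unfolding d_def step by (simp add: divide_simps) (simp add: algebra_simps)
  have "d \<longlonglongrightarrow> 0"
  proof (rule LIMSEQ_I)
    fix \<epsilon> :: real
    assume "\<epsilon> > 0"
    \<comment> \<open>Chosen so that \<open>\<epsilon> / 2\<close> is the fixed point of
      \<open>t \<mapsto> \<bar>r\<bar> * t + \<delta>\<close>; hence the bound below reproduces
      itself in the induction.\<close>
    define \<delta> where "\<delta> = \<epsilon> / 2 * (1 - \<bar>r\<bar>)"
    have "\<delta> > 0" using \<open>\<epsilon> > 0\<close> r by (simp add: \<delta>_def)
    then obtain N where N: "\<And>k. k \<ge> N \<Longrightarrow> \<bar>w k - l\<bar> < \<delta>"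
      using LIMSEQ_D[OF w, of \<delta>] by auto
    have bound: "\<bar>d (N + k)\<bar> \<le> \<bar>r\<bar> ^ k * \<bar>d N\<bar> + \<epsilon> / 2" for k
    proof (induction k)
      case 0
      then show ?case using \<open>\<epsilon> > 0\<close> by simp
    next
      case (Suc k)
      have "\<bar>d (N + Suc k)\<bar> \<le> \<bar>r\<bar> * \<bar>d (N + k)\<bar> + \<delta>"
        using N[of "N + k"] abs_triangle_ineq[of "r * d (N + k)" "w (N + k) - l"]
        by (simp add: d_step abs_mult)
      also have "\<dots> \<le> \<bar>r\<bar> * (\<bar>r\<bar> ^ k * \<bar>d N\<bar> + \<epsilon> / 2) + \<delta>"
        using mult_left_mono[OF Suc abs_ge_zero[of r]] by simp
      also have "\<dots> = \<bar>r\<bar> ^ Suc k * \<bar>d N\<bar> + \<epsilon> / 2"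
        by (simp add: \<delta>_def field_simps)
      finally show ?case .
    qed
    have "(\<lambda>k. \<bar>r\<bar> ^ k * \<bar>d N\<bar>) \<longlonglongrightarrow> 0"
      using r by (intro tendsto_mult_left_zero LIMSEQ_realpow_zero) auto
    then obtain K where K: "\<And>k. k \<ge> K \<Longrightarrow> \<bar>r\<bar> ^ k * \<bar>d N\<bar> < \<epsilon> / 2"
      using LIMSEQ_D[of _ 0 "\<epsilon> / 2"] \<open>\<epsilon> > 0\<close> by (fastforce simp: abs_mult power_abs)
    have "norm (d k - 0) < \<epsilon>" if "k \<ge> N + K" for k
    proof -
      have "K \<le> k - N" "N + (k - N) = k" using that by auto
      then show ?thesis using bound[of "k - N"] K[of "k - N"] by simp
    qed
    then show "\<exists>no. \<forall>k\<ge>no. norm (d k - 0) < \<epsilon>" by blast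
  qed
  then show ?thesis
    unfolding d_def by (simp add: LIM_zero_iff)
qed

section \<open>Square-integrable random variables\<close>

text \<open>Measurability of the square determines only that of \<open>\<bar>X\<bar>\<close>, not
  the sign, so measurability of \<open>X\<close> is a separate clause.\<close>

definition square_integrable :: "'a measure \<Rightarrow> ('a \<Rightarrow> real) \<Rightarrow> bool" where
  "square_integrable M X \<longleftrightarrow> X \<in> borel_measurable M \<and> integrable M (\<lambda>\<omega>. (X \<omega>)\<^sup>2)"

lemma square_integrable_mult:
  assumes "square_integrable M X" and "square_integrable M Y"
  shows "integrable M (\<lambda>\<omega>. X \<omega> * Y \<omega>)"
proof (rule Bochner_Integration.integrable_bound)
  show "integrable M (\<lambda>\<omega>. (X \<omega>)\<^sup>2 + (Y \<omega>)\<^sup>2)"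
    using assms by (auto simp: square_integrable_def)
  show "(\<lambda>\<omega>. X \<omega> * Y \<omega>) \<in> borel_measurable M"
    using assms by (auto simp: square_integrable_def)
  have "\<bar>x * y\<bar> \<le> x\<^sup>2 + y\<^sup>2" for x y :: real
    using sum_squares_bound[of x y] sum_squares_bound[of x "- y"] zero_le_power2[of x] zero_le_power2[of y]
    by (simp add: abs_le_iff)
  then show "AE \<omega> in M. norm (X \<omega> * Y \<omega>) \<le> norm ((X \<omega>)\<^sup>2 + (Y \<omega>)\<^sup>2)"
    by simp
qed

lemma square_integrable_cmult:
  "square_integrable M X \<Longrightarrow> square_integrable M (\<lambda>\<omega>. c * X \<omega>)"
  by (auto simp: square_integrable_def power_mult_distrib)

lemma square_integrable_add:
  assumes "square_integrable M X" and "square_integrable M Y"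
  shows "square_integrable M (\<lambda>\<omega>. X \<omega> + Y \<omega>)"
  using assms square_integrable_mult[OF assms]
  by (auto simp: square_integrable_def power2_sum mult.assoc)

lemma (in finite_measure) square_integrable_const: "square_integrable M (\<lambda>\<omega>. c)"
  by (simp add: square_integrable_def)

lemma (in finite_measure) square_integrable_imp_integrable:
  "square_integrable M X \<Longrightarrow> integrable M X"
  using square_integrable_mult[OF _ square_integrable_const[of 1]] by simp

text \<open>\<open>X\<close> and \<open>Y\<close> play the current state and \<open>E\<close> the
  fresh noise, orthogonal to both. Two independent sets of coefficients let one expansion serve both
  squares and the mixed moment.\<close>

lemma integral_bilinear:
  fixes p r s p' r' s' :: real
  assumes "square_integrable M X" "square_integrable M Y" "square_integrable M E"
    and "(\<integral>\<omega>. X \<omega> * E \<omega> \<partial>M) = 0" and "(\<integral>\<omega>. Y \<omega> * E \<omega> \<partial>M) = 0"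
  shows "(\<integral>\<omega>. (p * X \<omega> + r * Y \<omega> + s * E \<omega>) * (p' * X \<omega> + r' * Y \<omega> + s' * E \<omega>) \<partial>M) =
    p * p' * (\<integral>\<omega>. (X \<omega>)\<^sup>2 \<partial>M) + (p * r' + r * p') * (\<integral>\<omega>. X \<omega> * Y \<omega> \<partial>M) +
    r * r' * (\<integral>\<omega>. (Y \<omega>)\<^sup>2 \<partial>M) + s * s' * (\<integral>\<omega>. (E \<omega>)\<^sup>2 \<partial>M)"
proof -
  have int: "integrable M (\<lambda>\<omega>. (X \<omega>)\<^sup>2)" "integrable M (\<lambda>\<omega>. (Y \<omega>)\<^sup>2)"
    "integrable M (\<lambda>\<omega>. (E \<omega>)\<^sup>2)" "integrable M (\<lambda>\<omega>. X \<omega> * Y \<omega>)"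
    "integrable M (\<lambda>\<omega>. X \<omega> * E \<omega>)" "integrable M (\<lambda>\<omega>. Y \<omega> * E \<omega>)"
    using assms by (auto simp: square_integrable_def intro: square_integrable_mult)
  have "(p * X \<omega> + r * Y \<omega> + s * E \<omega>) * (p' * X \<omega> + r' * Y \<omega> + s' * E \<omega>) =
      p * p' * (X \<omega>)\<^sup>2 + (p * r' + r * p') * (X \<omega> * Y \<omega>) + r * r' * (Y \<omega>)\<^sup>2 + s * s' * (E \<omega>)\<^sup>2 +
      (p * s' + s * p') * (X \<omega> * E \<omega>) + (r * s' + s * r') * (Y \<omega> * E \<omega>)" for \<omega>
    by (simp add: algebra_simps power2_eq_square)
  then show ?thesis
    using int assms by simp
qed

section \<open>Second moments of one coordinate\<close>

text \<open>The vector noise enters through one scaled coordinate, described by the moments that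
  occur in the recursions below.\<close>

locale white_noise = prob_space M for M :: "'a measure" +
  fixes e :: "nat \<Rightarrow> 'a \<Rightarrow> real" and v :: real
  assumes noise_square_integrable: "square_integrable M (e k)"
    and noise_mean: "(\<integral>\<omega>. e k \<omega> \<partial>M) = 0"
    and noise_uncorrelated: "j \<noteq> k \<Longrightarrow> (\<integral>\<omega>. e j \<omega> * e k \<omega> \<partial>M) = 0"
    and noise_variance: "(\<integral>\<omega>. (e k \<omega>)\<^sup>2 \<partial>M) = v"

text \<open>One coordinate of the centered pair: \<open>x\<close> is the iterate and
  \<open>y\<close> its average, both minus \<open>\<mu>\<close>. Here \<open>c\<close> is the
  diagonal entry of \<open>C\<close>, \<open>p\<close> is one minus \<open>\<eta>\<close> times that
  of \<open>A\<close> minus \<open>c\<close>, and \<open>e\<close> absorbs the factor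
  \<open>- \<eta>\<close>.\<close>

locale driven_ema = white_noise M e v for M :: "'a measure" and e v +
  fixes x y :: "nat \<Rightarrow> 'a \<Rightarrow> real" and x0 y0 p c \<beta> :: real
  assumes x_0: "x 0 \<omega> = x0" and y_0: "y 0 \<omega> = y0"
    and x_Suc: "x (Suc k) \<omega> = p * x k \<omega> + c * y k \<omega> + e k \<omega>"
    and y_Suc_average: "y (Suc k) \<omega> = (1 - \<beta>) * y k \<omega> + \<beta> * x (Suc k) \<omega>"
begin

lemma y_Suc: "y (Suc k) \<omega> = (\<beta> * p) * x k \<omega> + (1 - \<beta> + \<beta> * c) * y k \<omega> + \<beta> * e k \<omega>"
  by (simp add: y_Suc_average x_Suc algebra_simps)

lemma square_integrable_state: "square_integrable M (x k) \<and> square_integrable M (y k)"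
proof (induction k)
  case 0
  have "x 0 = (\<lambda>\<omega>. x0)" "y 0 = (\<lambda>\<omega>. y0)"
    by (simp_all add: x_0 y_0 fun_eq_iff)
  then show ?case by (simp add: square_integrable_const)
next
  case (Suc k)
  have "x (Suc k) = (\<lambda>\<omega>. p * x k \<omega> + c * y k \<omega> + e k \<omega>)"
    "y (Suc k) = (\<lambda>\<omega>. (\<beta> * p) * x k \<omega> + (1 - \<beta> + \<beta> * c) * y k \<omega> + \<beta> * e k \<omega>)"
    using x_Suc y_Suc by auto
  then show ?case
    using Suc noise_square_integrable
    by (simp add: square_integrable_add square_integrable_cmult)
qed

text \<open>The state at time \<open>k\<close> is a linear combination of constants and of the noise
  strictly before \<open>k\<close>. Therefore \<open>j = k\<close> is included, which is the case
  needed for one step.\<close>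

lemma state_uncorrelated:
  "k \<le> j \<Longrightarrow> (\<integral>\<omega>. x k \<omega> * e j \<omega> \<partial>M) = 0 \<and> (\<integral>\<omega>. y k \<omega> * e j \<omega> \<partial>M) = 0"
proof (induction k)
  case 0
  \<comment> \<open>The initial values are deterministic, so the noise mean alone decides.\<close>
  then show ?case by (simp add: x_0 y_0 noise_mean)
next
  case (Suc k)
  have int: "integrable M (\<lambda>\<omega>. x k \<omega> * e j \<omega>)" "integrable M (\<lambda>\<omega>. y k \<omega> * e j \<omega>)"
    "integrable M (\<lambda>\<omega>. e k \<omega> * e j \<omega>)"
    using square_integrable_state noise_square_integrable by (auto intro: square_integrable_mult)
  have lin: "(\<integral>\<omega>. (r * x k \<omega> + s * y k \<omega> + t * e k \<omega>) * e j \<omega> \<partial>M) = 0" for r s t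
    using int Suc noise_uncorrelated[of k j] by (simp add: distrib_right mult.assoc)
  show ?case
    using lin[of p c 1] lin[of "\<beta> * p" "1 - \<beta> + \<beta> * c" \<beta>] by (simp add: x_Suc y_Suc)
qed

lemmas step_moment = integral_bilinear[OF conjunct1[OF square_integrable_state]
    conjunct2[OF square_integrable_state] noise_square_integrable
    conjunct1[OF state_uncorrelated[OF order_refl]]
    conjunct2[OF state_uncorrelated[OF order_refl]], unfolded noise_variance]

text \<open>This and the next two recursions form a closed linear system. It is triangular for
  \<open>c = 0\<close>, and for \<open>p = 0\<close> the moment of \<open>y\<close> evolves by
  itself.\<close>

lemma second_moment_x_Suc:
  "(\<integral>\<omega>. (x (Suc k) \<omega>)\<^sup>2 \<partial>M) = p\<^sup>2 * (\<integral>\<omega>. (x k \<omega>)\<^sup>2 \<partial>M) +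
    2 * p * c * (\<integral>\<omega>. x k \<omega> * y k \<omega> \<partial>M) + c\<^sup>2 * (\<integral>\<omega>. (y k \<omega>)\<^sup>2 \<partial>M) + v"
  using step_moment[of p k c 1 p c 1] by (simp add: x_Suc power2_eq_square algebra_simps)

lemma mixed_moment_Suc:
  "(\<integral>\<omega>. x (Suc k) \<omega> * y (Suc k) \<omega> \<partial>M) = \<beta> * p\<^sup>2 * (\<integral>\<omega>. (x k \<omega>)\<^sup>2 \<partial>M) +
    p * (1 - \<beta> + 2 * \<beta> * c) * (\<integral>\<omega>. x k \<omega> * y k \<omega> \<partial>M) +
    c * (1 - \<beta> + \<beta> * c) * (\<integral>\<omega>. (y k \<omega>)\<^sup>2 \<partial>M) + \<beta> * v"
proof -
  have "p * (1 - \<beta> + \<beta> * c) + c * (\<beta> * p) = p * (1 - \<beta> + 2 * \<beta> * c)"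
    "p * (\<beta> * p) = \<beta> * p\<^sup>2"
    by (simp_all add: algebra_simps power2_eq_square)
  then show ?thesis
    using step_moment[of p k c 1 "\<beta> * p" "1 - \<beta> + \<beta> * c" \<beta>] by (simp only: x_Suc y_Suc mult_1)
qed

lemma second_moment_y_Suc:
  "(\<integral>\<omega>. (y (Suc k) \<omega>)\<^sup>2 \<partial>M) = (\<beta> * p)\<^sup>2 * (\<integral>\<omega>. (x k \<omega>)\<^sup>2 \<partial>M) +
    2 * (\<beta> * p) * (1 - \<beta> + \<beta> * c) * (\<integral>\<omega>. x k \<omega> * y k \<omega> \<partial>M) +
    (1 - \<beta> + \<beta> * c)\<^sup>2 * (\<integral>\<omega>. (y k \<omega>)\<^sup>2 \<partial>M) + \<beta>\<^sup>2 * v"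
proof -
  have "(\<beta> * p) * (1 - \<beta> + \<beta> * c) + (1 - \<beta> + \<beta> * c) * (\<beta> * p) =
      2 * (\<beta> * p) * (1 - \<beta> + \<beta> * c)"
    by simp
  then show ?thesis
    using step_moment[of "\<beta> * p" k "1 - \<beta> + \<beta> * c" \<beta> "\<beta> * p" "1 - \<beta> + \<beta> * c" \<beta>]
    by (simp only: y_Suc power2_eq_square)
qed

text \<open>The triangular system is solved in the order \<open>x\<close> squared, \<open>x\<close>
  times \<open>y\<close>, \<open>y\<close> squared, with contraction factors
  \<open>p\<^sup>2\<close>, \<open>p * b\<close> and \<open>b\<^sup>2\<close>; each limit enters the
  forcing of the next recursion.\<close>

lemma second_moment_limit_uncoupled:
  assumes "c = 0" and "0 < p" "p < 1" "0 < \<beta>" "\<beta> < 1"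
  shows "(\<lambda>k. \<integral>\<omega>. (y k \<omega>)\<^sup>2 \<partial>M) \<longlonglongrightarrow>
    \<beta>\<^sup>2 * v * (1 + p * (1 - \<beta>)) / ((1 - p * (1 - \<beta>)) * (1 - p\<^sup>2) * (1 - (1 - \<beta>)\<^sup>2))"
proof -
  define b where "b = 1 - \<beta>"
  have b: "0 < b" "b < 1" using assms by (auto simp: b_def)
  have sq: "p\<^sup>2 < 1" "b\<^sup>2 < 1" "p * b < 1"
    using assms b by (auto simp: power_less_one_iff abs_square_less_1 intro: mult_strict_mono[of p 1 b 1, simplified])
  define X where "X = v / (1 - p\<^sup>2)"
  define P where "P = (\<beta> * p\<^sup>2 * X + \<beta> * v) / (1 - p * b)"
  have X_lim: "(\<lambda>k. \<integral>\<omega>. (x k \<omega>)\<^sup>2 \<partial>M) \<longlonglongrightarrow> X"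
    unfolding X_def
  proof (rule tendsto_affine_recursion)
    show "(\<integral>\<omega>. (x (Suc k) \<omega>)\<^sup>2 \<partial>M) = p\<^sup>2 * (\<integral>\<omega>. (x k \<omega>)\<^sup>2 \<partial>M) + v" for k
      by (simp add: second_moment_x_Suc assms)
  qed (use sq in auto)
  have P_lim: "(\<lambda>k. \<integral>\<omega>. x k \<omega> * y k \<omega> \<partial>M) \<longlonglongrightarrow> P"
    unfolding P_def
  proof (rule tendsto_affine_recursion)
    show "(\<integral>\<omega>. x (Suc k) \<omega> * y (Suc k) \<omega> \<partial>M) = p * b * (\<integral>\<omega>. x k \<omega> * y k \<omega> \<partial>M) +
        (\<beta> * p\<^sup>2 * (\<integral>\<omega>. (x k \<omega>)\<^sup>2 \<partial>M) + \<beta> * v)" for k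
      by (simp add: mixed_moment_Suc assms b_def)
    show "(\<lambda>k. \<beta> * p\<^sup>2 * (\<integral>\<omega>. (x k \<omega>)\<^sup>2 \<partial>M) + \<beta> * v) \<longlonglongrightarrow> \<beta> * p\<^sup>2 * X + \<beta> * v"
      by (intro tendsto_intros X_lim)
  qed (use sq assms b in \<open>auto simp: abs_mult\<close>)
  have "(\<lambda>k. \<integral>\<omega>. (y k \<omega>)\<^sup>2 \<partial>M) \<longlonglongrightarrow>
      ((\<beta> * p)\<^sup>2 * X + 2 * (\<beta> * p) * b * P + \<beta>\<^sup>2 * v) / (1 - b\<^sup>2)"
  proof (rule tendsto_affine_recursion)
    show "(\<integral>\<omega>. (y (Suc k) \<omega>)\<^sup>2 \<partial>M) = b\<^sup>2 * (\<integral>\<omega>. (y k \<omega>)\<^sup>2 \<partial>M) +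
        ((\<beta> * p)\<^sup>2 * (\<integral>\<omega>. (x k \<omega>)\<^sup>2 \<partial>M) + 2 * (\<beta> * p) * b * (\<integral>\<omega>. x k \<omega> * y k \<omega> \<partial>M) + \<beta>\<^sup>2 * v)" for k
      by (simp add: second_moment_y_Suc assms b_def)
    show "(\<lambda>k. (\<beta> * p)\<^sup>2 * (\<integral>\<omega>. (x k \<omega>)\<^sup>2 \<partial>M) +
        2 * (\<beta> * p) * b * (\<integral>\<omega>. x k \<omega> * y k \<omega> \<partial>M) + \<beta>\<^sup>2 * v) \<longlonglongrightarrow>
        (\<beta> * p)\<^sup>2 * X + 2 * (\<beta> * p) * b * P + \<beta>\<^sup>2 * v"
      by (intro tendsto_intros X_lim P_lim)
  qed (use sq in auto)
  moreover have "(\<beta> * p)\<^sup>2 * X + 2 * (\<beta> * p) * b * P + \<beta>\<^sup>2 * v =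
      \<beta>\<^sup>2 * v * (1 + p * b) / ((1 - p * b) * (1 - p\<^sup>2))"
  proof -
    \<comment> \<open>Trading \<open>v\<close> for \<open>X\<close> collapses the numerator of
      \<open>P\<close> to \<open>\<beta> * X\<close>, and the total becomes
      \<open>\<beta>\<^sup>2 * X * (1 + 2 * p * b / (1 - p * b))\<close>.\<close>
    have v: "v = X * (1 - p\<^sup>2)" using sq by (simp add: X_def)
    have P: "P = \<beta> * X / (1 - p * b)" unfolding P_def by (simp add: v algebra_simps)
    show ?thesis
      using sq unfolding P v
      by (simp add: divide_simps) (simp add: algebra_simps power2_eq_square)
  qed
  ultimately show ?thesis
    by (simp add: b_def mult.assoc)
qed

text \<open>For \<open>p = 0\<close> the average no longer sees \<open>x\<close>: it is an AR(1)
  process with innovation \<open>\<beta> * e k\<close>, and the forcing is constant.\<close>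

lemma second_moment_limit_cancelled:
  assumes "p = 0" and "\<bar>1 - \<beta> + \<beta> * c\<bar> < 1"
  shows "(\<lambda>k. \<integral>\<omega>. (y k \<omega>)\<^sup>2 \<partial>M) \<longlonglongrightarrow> \<beta>\<^sup>2 * v / (1 - (1 - \<beta> + \<beta> * c)\<^sup>2)"
proof (rule tendsto_affine_recursion)
  show "(\<integral>\<omega>. (y (Suc k) \<omega>)\<^sup>2 \<partial>M) =
      (1 - \<beta> + \<beta> * c)\<^sup>2 * (\<integral>\<omega>. (y k \<omega>)\<^sup>2 \<partial>M) + \<beta>\<^sup>2 * v" for k
    by (simp add: second_moment_y_Suc assms)
  show "\<bar>(1 - \<beta> + \<beta> * c)\<^sup>2\<bar> < 1"
    using assms(2) by (simp only: abs_square_less_1 abs_power2)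
qed auto

end

section \<open>Comparison of the two limiting variances\<close>

lemma cancelled_variance_less:
  fixes \<beta> q v :: real
  assumes "0 < \<beta>" "\<beta> < 1" "0 < q" "q < 1" "0 < v"
  shows "\<beta>\<^sup>2 * v / (1 - (1 - \<beta> + \<beta> * q)\<^sup>2) <
    \<beta>\<^sup>2 * v * (1 + q * (1 - \<beta>)) / ((1 - q * (1 - \<beta>)) * (1 - q\<^sup>2) * (1 - (1 - \<beta>)\<^sup>2))"
proof -
  define b where "b = 1 - \<beta>"
  have b: "0 < b" "b < 1" using assms by (auto simp: b_def)
  have bq: "b * q < 1" "0 < b * q" using mult_strict_mono[of b 1 q 1] b assms by auto
  \<comment> \<open>Common factor of both denominators: with \<open>a = b + q - b * q\<close> one
    has \<open>1 - a = K\<close>, while on the other side it comes from \<open>1 - q\<^sup>2\<close>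
    and \<open>1 - b\<^sup>2\<close>.\<close>
  define K where "K = (1 - b) * (1 - q)"
  have K: "K > 0" using b assms by (simp add: K_def)
  have L: "1 - (1 - \<beta> + \<beta> * q)\<^sup>2 = K * (1 + b + q - b * q)"
    by (simp add: K_def b_def algebra_simps power2_eq_square)
  have R: "(1 - q * (1 - \<beta>)) * (1 - q\<^sup>2) * (1 - (1 - \<beta>)\<^sup>2) =
      K * ((1 - b * q) * (1 + q) * (1 + b))"
    unfolding b_def[symmetric] by (simp add: K_def algebra_simps power2_eq_square)
  have "(1 + b * q) * (1 + b + q - b * q) = (1 - b * q) * (1 + q) * (1 + b) + 2 * (b * q) * (b + q)"
    by (simp add: algebra_simps power2_eq_square)
  then have key: "(1 - b * q) * (1 + q) * (1 + b) < (1 + b * q) * (1 + b + q - b * q)"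
    using b assms by simp
  have pos: "0 < 1 + b + q - b * q" "0 < (1 - b * q) * (1 + q) * (1 + b)"
    using b assms bq by (auto intro!: mult_pos_pos)
  have "1 / (1 + b + q - b * q) < (1 + b * q) / ((1 - b * q) * (1 + q) * (1 + b))"
    using key pos by (simp add: divide_less_eq less_divide_eq)
  then have "\<beta>\<^sup>2 * v / K * (1 / (1 + b + q - b * q)) <
      \<beta>\<^sup>2 * v / K * ((1 + b * q) / ((1 - b * q) * (1 + q) * (1 + b)))"
    using assms K by (intro mult_strict_left_mono) auto
  then show ?thesis
    unfolding L R by (simp add: b_def mult.commute)
qed

section \<open>From vectors to coordinates\<close>

lemma diagonal_matrix_mult_vec_nth:
  assumes "diagonal_matrix D"
  shows "(D *v x) $ i = D $ i $ i * x $ i"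
proof -
  have "(D *v x) $ i = (\<Sum>j\<in>UNIV. if j = i then D $ i $ i * x $ i else 0)"
    unfolding matrix_vector_mult_def vec_lambda_beta
    using assms by (intro sum.cong) (auto simp: diagonal_matrix_def)
  then show ?thesis by simp
qed

text \<open>Evaluate at a unit basis vector: the image has this entry as a coordinate, bounded by
  its norm.\<close>

lemma diagonal_entry_le_onorm:
  fixes D :: "real^'n^'n"
  shows "\<bar>D $ i $ i\<bar> \<le> onorm ((*v) D)"
proof -
  have "\<bar>D $ i $ i\<bar> = \<bar>(D *v axis i 1) $ i\<bar>"
    by (simp add: matrix_vector_mult_basis column_def)
  also have "\<dots> \<le> norm (D *v axis i 1)"
    by (rule component_le_norm_cart)
  also have "\<dots> \<le> onorm ((*v) D) * norm (axis i (1::real) :: real^'n)"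
    by (rule onorm) simp
  finally show ?thesis by (simp add: norm_axis_1)
qed

lemma positive_definite_diagonal_pos:
  fixes A :: "real^'n^'n"
  assumes "positive_definite A"
  shows "0 < A $ i $ i"
proof -
  have "axis i (1::real) \<noteq> (0 :: real^'n)" by (simp add: axis_eq_0_iff)
  then have "0 < axis i 1 \<bullet> (A *v axis i 1)"
    using assms by (simp add: positive_definite_def)
  then show ?thesis
    by (simp add: matrix_vector_mult_basis column_def inner_axis')
qed

text \<open>The variance is a diagonal entry of the covariance, and independence factors mixed
  moments into products of zero means. The scale \<open>t\<close> will be
  \<open>- \<eta>\<close>.\<close>

lemma white_noise_component:
  fixes \<xi> :: "nat \<Rightarrow> 'a \<Rightarrow> real^'n"
  assumes "prob_space M" and noise: "iid_noise M \<sigma> \<xi>"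
  shows "white_noise M (\<lambda>k \<omega>. t * \<xi> k \<omega> $ i) (t\<^sup>2 * \<sigma>\<^sup>2)"
proof -
  interpret prob_space M by fact
  have indep: "indep_vars (\<lambda>_. borel) \<xi> UNIV"
    and sq: "integrable M (\<lambda>\<omega>. (norm (\<xi> k \<omega>))\<^sup>2)"
    and mean: "(\<integral>\<omega>. \<xi> k \<omega> \<partial>M) = 0"
    and cov: "covariance_matrix M (\<xi> k) = \<sigma>\<^sup>2 *\<^sub>R mat 1" for k
    using noise by (auto simp: iid_noise_def)
  have meas[measurable]: "\<xi> k \<in> borel_measurable M" for k
    using indep by (auto simp: indep_vars_def)
  have comp: "square_integrable M (\<lambda>\<omega>. \<xi> k \<omega> $ i)" for k
    unfolding square_integrable_def
  proof
    show "(\<lambda>\<omega>. \<xi> k \<omega> $ i) \<in> borel_measurable M"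
      by (rule measurable_compose[OF meas]) simp
    then show "integrable M (\<lambda>\<omega>. (\<xi> k \<omega> $ i)\<^sup>2)"
      by (intro Bochner_Integration.integrable_bound[OF sq[of k]])
        (auto simp: component_le_norm_cart abs_le_square_iff[symmetric])
  qed
  have "square_integrable M (\<lambda>\<omega>. norm (\<xi> k \<omega>))" for k
    using sq by (simp add: square_integrable_def)
  \<comment> \<open>Vector integrability is what lets the coordinate projection pass through the
    integral.\<close>
  then have int: "integrable M (\<xi> k)" for k
    using square_integrable_imp_integrable integrable_norm_cancel[OF _ meas] by blast
  have comp_mean: "(\<integral>\<omega>. \<xi> k \<omega> $ i \<partial>M) = 0" for k
    using integral_bounded_linear[OF bounded_linear_vec_nth[of i] int[of k]] mean by simp
  have "(\<integral>\<omega>. (\<xi> k \<omega> $ i)\<^sup>2 \<partial>M) = \<sigma>\<^sup>2" for k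
    using arg_cong[OF cov[of k], of "\<lambda>D. D $ i $ i"]
    by (simp add: covariance_matrix_def comp_mean mat_def power2_eq_square)
  moreover have "(\<integral>\<omega>. \<xi> j \<omega> $ i * \<xi> k \<omega> $ i \<partial>M) = 0" if "j \<noteq> k" for j k
  proof -
    have "indep_vars (\<lambda>_. borel) (\<lambda>k \<omega>. \<xi> k \<omega> $ i) UNIV"
      using indep by (rule indep_vars_compose2) simp
    \<comment> \<open>Restricting to two indices turns the product formula for expectations into one
      with just two factors.\<close>
    then have "indep_vars (\<lambda>_. borel) (\<lambda>k \<omega>. \<xi> k \<omega> $ i) {j, k}"
      by (rule indep_vars_subset) simp
    from indep_vars_lebesgue_integral[OF _ this] show ?thesis
      using that by (simp add: square_integrable_imp_integrable[OF comp] comp_mean)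
  qed
  ultimately show ?thesis
    by unfold_locales
      (simp_all add: square_integrable_cmult comp comp_mean power_mult_distrib
        mult.assoc mult.left_commute[of "\<xi> _ _ $ _" t])
qed

text \<open>Diagonal matrices decouple the coordinates. Centering at \<open>\<mu>\<close> leaves
  \<open>m - \<theta>\<close> unchanged and respects the average, whose weights sum to one.\<close>

lemma driven_ema_component:
  fixes \<xi> :: "nat \<Rightarrow> 'a \<Rightarrow> real^'n"
  assumes "prob_space M" and "iid_noise M \<sigma> \<xi>"
    and "diagonal_matrix A" and "diagonal_matrix C"
  shows "driven_ema M (\<lambda>k \<omega>. - \<eta> * \<xi> k \<omega> $ i) (\<eta>\<^sup>2 * \<sigma>\<^sup>2)
    (\<lambda>k \<omega>. (fst (ema_sgd A \<mu> C \<eta> \<beta> (\<lambda>k. \<xi> k \<omega>) \<theta>0 m0 k) - \<mu>) $ i)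
    (\<lambda>k \<omega>. (snd (ema_sgd A \<mu> C \<eta> \<beta> (\<lambda>k. \<xi> k \<omega>) \<theta>0 m0 k) - \<mu>) $ i)
    ((\<theta>0 - \<mu>) $ i) ((m0 - \<mu>) $ i) (1 - \<eta> * A $ i $ i - C $ i $ i) (C $ i $ i) \<beta>"
proof -
  interpret white_noise M "\<lambda>k \<omega>. - \<eta> * \<xi> k \<omega> $ i" "\<eta>\<^sup>2 * \<sigma>\<^sup>2"
    using white_noise_component[OF assms(1,2), of "- \<eta>" i] by simp
  show ?thesis
    by unfold_locales
      (auto simp: Let_def case_prod_beta stochastic_gradient_def
        diagonal_matrix_mult_vec_nth[OF assms(3)] diagonal_matrix_mult_vec_nth[OF assms(4)]
        algebra_simps)
qed

lemma ema_sq_error_tendsto: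
  fixes \<xi> :: "nat \<Rightarrow> 'a \<Rightarrow> real^'n"
  assumes "prob_space M" and "iid_noise M \<sigma> \<xi>"
    and "diagonal_matrix A" and "diagonal_matrix C"
    and lim: "\<And>i. (\<lambda>T. \<integral>\<omega>. ((snd (ema_sgd A \<mu> C \<eta> \<beta> (\<lambda>k. \<xi> k \<omega>) \<theta>0 m0 T) - \<mu>) $ i)\<^sup>2 \<partial>M)
      \<longlonglongrightarrow> l i"
  shows "ema_sq_error M \<xi> A \<mu> C \<eta> \<beta> \<theta>0 m0 \<longlonglongrightarrow> (\<Sum>i\<in>UNIV. l i)"
proof -
  have "ema_sq_error M \<xi> A \<mu> C \<eta> \<beta> \<theta>0 m0 T = (\<Sum>i\<in>UNIV.
      \<integral>\<omega>. ((snd (ema_sgd A \<mu> C \<eta> \<beta> (\<lambda>k. \<xi> k \<omega>) \<theta>0 m0 T) - \<mu>) $ i)\<^sup>2 \<partial>M)" for T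
  proof -
    have norm_sq: "(norm z)\<^sup>2 = (\<Sum>i\<in>UNIV. (z $ i)\<^sup>2)" for z :: "real^'n"
      by (simp add: norm_vec_def L2_set_def sum_nonneg)
    show ?thesis
      unfolding ema_sq_error_def norm_sq
      using driven_ema.square_integrable_state[OF driven_ema_component[OF assms(1-4)]]
      by (intro Bochner_Integration.integral_sum) (simp add: square_integrable_def)
  qed
  then show ?thesis
    using tendsto_sum[of UNIV _ l, OF lim] by presburger
qed

section \<open>Choice of the coupling matrix and summation over coordinates\<close>

theorem proposition2:
  fixes A :: "real^'n^'n" and \<mu> :: "real^'n" and \<sigma> \<eta> \<beta> :: real
    and M :: "'a measure" and \<xi> :: "nat \<Rightarrow> 'a \<Rightarrow> real^'n"
  assumes "diagonal_matrix A" and "positive_definite A"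
    and "prob_space M" and "\<sigma> > 0" and "iid_noise M \<sigma> \<xi>"
    and "\<eta> > 0" and "onorm ((*v) (\<eta> *\<^sub>R A)) < 1"
    and "0 < \<beta>" and "\<beta> < 1"
  shows "\<exists>C :: real^'n^'n. diagonal_matrix C \<and> (\<forall>i. 0 \<le> C $ i $ i \<and> C $ i $ i \<le> 1) \<and>
    (\<forall>\<theta>0 m0 \<theta>0' m0'.
       convergent (ema_sq_error M \<xi> A \<mu> C \<eta> \<beta> \<theta>0 m0) \<and>
       convergent (ema_sq_error M \<xi> A \<mu> 0 \<eta> \<beta> \<theta>0' m0') \<and>
       lim (ema_sq_error M \<xi> A \<mu> C \<eta> \<beta> \<theta>0 m0) < lim (ema_sq_error M \<xi> A \<mu> 0 \<eta> \<beta> \<theta>0' m0'))"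
proof -
  define q where "q i = 1 - \<eta> * A $ i $ i" for i
  \<comment> \<open>This is \<open>I - \<eta> A\<close>, which makes the coefficient
    \<open>p\<close> of every coordinate vanish.\<close>
  define C :: "real^'n^'n" where "C = (\<chi> i j. if i = j then q i else 0)"
  define v where "v = \<eta>\<^sup>2 * \<sigma>\<^sup>2"
  have v: "0 < v" using assms by (simp add: v_def)
  \<comment> \<open>The operator norm bound gives positivity; positive definiteness gives the upper
    bound.\<close>
  have q: "0 < q i" "q i < 1" for i
    using diagonal_entry_le_onorm[of "\<eta> *\<^sub>R A" i] assms(7)
      mult_pos_pos[OF assms(6) positive_definite_diagonal_pos[OF assms(2), of i]]
    by (auto simp: q_def)
  have C: "diagonal_matrix C" and C_nth: "C $ i $ i = q i" for i
    by (auto simp: diagonal_matrix_def C_def)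
  have zero: "diagonal_matrix (0 :: real^'n^'n)"
    by (simp add: diagonal_matrix_def)
  \<comment> \<open>The coefficient is a convex combination of \<open>1\<close> and
    \<open>q i\<close>, strictly between zero and one.\<close>
  have \<rho>: "\<bar>1 - \<beta> + \<beta> * q i\<bar> < 1" for i
    using assms(8,9) q[of i] mult_strict_left_mono[of "q i" 1 \<beta>] mult_pos_pos[of \<beta> "q i"]
    by auto
  define lC where "lC i = \<beta>\<^sup>2 * v / (1 - (1 - \<beta> + \<beta> * q i)\<^sup>2)" for i
  define l0 where "l0 i = \<beta>\<^sup>2 * v * (1 + q i * (1 - \<beta>)) /
    ((1 - q i * (1 - \<beta>)) * (1 - (q i)\<^sup>2) * (1 - (1 - \<beta>)\<^sup>2))" for i
  \<comment> \<open>The limits are free of the initial values, so one comparison covers all starting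
    points of both processes.\<close>
  have limC: "ema_sq_error M \<xi> A \<mu> C \<eta> \<beta> \<theta>0 m0 \<longlonglongrightarrow> (\<Sum>i\<in>UNIV. lC i)" for \<theta>0 m0
    using driven_ema.second_moment_limit_cancelled[OF driven_ema_component[OF assms(3,5,1) C]] \<rho>
    by (intro ema_sq_error_tendsto[OF assms(3,5,1) C]) (simp add: C_nth lC_def q_def v_def)
  \<comment> \<open>Now \<open>c = 0\<close> and \<open>p = q i\<close>.\<close>
  have lim0: "ema_sq_error M \<xi> A \<mu> 0 \<eta> \<beta> \<theta>0 m0 \<longlonglongrightarrow> (\<Sum>i\<in>UNIV. l0 i)" for \<theta>0 m0
    using driven_ema.second_moment_limit_uncoupled[OF driven_ema_component[OF assms(3,5,1) zero]]
      q assms(8,9)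
    by (intro ema_sq_error_tendsto[OF assms(3,5,1) zero]) (simp add: l0_def q_def v_def)
  have "(\<Sum>i\<in>UNIV. lC i) < (\<Sum>i\<in>UNIV. l0 i)"
    unfolding lC_def l0_def
    by (intro sum_strict_mono cancelled_variance_less) (use assms q v in auto)
  then have "lim (ema_sq_error M \<xi> A \<mu> C \<eta> \<beta> \<theta>0 m0) <
      lim (ema_sq_error M \<xi> A \<mu> 0 \<eta> \<beta> \<theta>0' m0')" for \<theta>0 m0 \<theta>0' m0'
    using limI[OF limC] limI[OF lim0] by simp
  moreover have "\<forall>i. 0 \<le> C $ i $ i \<and> C $ i $ i \<le> 1"
    using q C_nth by (auto intro: less_imp_le)
  ultimately show ?thesis
    using C limC lim0 by (blast intro: convergentI)
qed

end
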